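(* Let $\mathcal{L}$ be a linear network with resistance metric $\mathrm{d}_R$ and auxiliary Gaussian random field $\{A(s):s\in\mathcal{L}\}$. Let $a,b:\mathcal{L}\to(0,\infty)$ be functions, put $\alpha(s,t)=[a(s)+a(t)]/2$, and let $F$ be a probability measure on $(0,\infty)$. Let $Z$ be a real-valued random variable with probability density function $g$. Let $W$ be a positive random variable with distribution $F$. Let $\epsilon$ be a random variable with zero mean and unit variance. Assume that $Z$, $W$, $\epsilon$ and $A$ are mutually independent. Let $\phi(\cdot;\mu,\sigma^2)$ denote the probability density function of a normal distribution with mean $\mu$ and variance $\sigma^2$. Then the random field $$X(s)=\epsilon\,\sqrt{\frac{b(s)}{g(Z)}}\left(\frac{\pi}{W}\right)^{1/4}\phi\left(Z;\frac{A(s)}{\sqrt{2}},\frac{a(s)}{4W}\right),\qquad s\in\mathcal{L},$$ has zero mean and covariance function $$\mathrm{cov}[X(s),X(t)]=\int_0^\infty\frac{\sqrt{b(s)b(t)}}{\sqrt{\alpha(s,t)+\mathrm{d}_R(s,t)\,w}}\,\mathrm{d}F(w),\qquad s,t\in\mathcal{L}.$$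
   Context: Linear network: $\mathcal{L}=\bigcup_{i=1}^m\ell_i\subset\mathbb{R}^2$ is a finite union ($m<\infty$) of closed line segments, each of positive finite length $|\ell_i|$ and intersecting other segments only at endpoints; $\mathcal{L}$ is assumed path-connected. Graph and matrix $\boldsymbol{\Delta}$: let $\mathcal{V}=\{v_1,\dots,v_n\}$ be the set of endpoints of the segments. Write $v_i\sim v_j$ if the distinct vertices $v_i,v_j$ are the two endpoints of one of the segments. Set $\mathrm{con}(v_i,v_j)=1/\|v_i-v_j\|$ (Euclidean norm) if $v_i\sim v_j$ and $\mathrm{con}(v_i,v_j)=0$ otherwise, and $c(v_i)=\sum_{v\sim v_i}\mathrm{con}(v_i,v)$. Fix an arbitrary reference vertex $v^*\in\mathcal{V}$ (the resulting resistance metric does not depend on this choice). The $n\times n$ matrix $\boldsymbol{\Delta}$ indexed by $\mathcal{V}$ has entries $\boldsymbol{\Delta}(v^*,v^* )=1+c(v^* )$, $\boldsymbol{\Delta}(v_i,v_i)=c(v_i)$ for $v_i\ne v^*$, and $\boldsymbol{\Delta}(v_i,v_j)=-\mathrm{con}(v_i,v_j)$ for $v_i\neq v_j$. It is strictly positive definite. Auxiliary Gaussian random field: $A(s)=A_0(s)+\sum_{i=1}^m A_i(s)$, $s\in\mathcal{L}$, where $A_0,\dots,A_m$ are independent Gaussian random fields such that: (i) $(A_0(v_1),\dots,A_0(v_n))^\top\sim\mathcal{N}_n(\mathbf{0},\boldsymbol{\Delta}^{-1})$, and $A_0$ is extended from the vertices to each segment by linear interpolation between the values at its endpoints; (ii)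 for $i=1,\dots,m$, $A_i(s)=B_i(s)$ for $s\in\ell_i$ and $A_i(s)=0$ for $s\in\mathcal{L}\setminus\ell_i$, where $B_1,\dots,B_m$ are independent standard Brownian bridges, $B_i$ being defined on an interval of length $|\ell_i|$ (starting and ending at zero), identified with $\ell_i$ through arc length parameterization, and independent of $A_0$. Resistance metric: $\mathrm{d}_R(s,t)=\mathrm{var}[A(s)-A(t)]$, $s,t\in\mathcal{L}$.
   Formalization: The density g of Z is additionally assumed positive almost everywhere on the real line; if g vanishes on a set of positive Lebesgue measure (e.g. Z uniform on [0,1]), the covariance is strictly smaller than the stated integral. *)

theory Defs
  imports "HOL-Probability.Probability"
begin

section \<open>Linear networks\<close>

text \<open>
  A network is given by a number \<open>m\<close> of segments and their endpoints \<open>p i\<close>, \<open>q i\<close> for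
  \<open>i = 1, \<dots>, m\<close>. The order of the two endpoints is arbitrary; it only serves to orient the
  arc length parameterization of the segment.
\<close>

definition segment :: "(nat \<Rightarrow> real ^ 2) \<Rightarrow> (nat \<Rightarrow> real ^ 2) \<Rightarrow> nat \<Rightarrow> (real ^ 2) set" where
  "segment p q i = closed_segment (p i) (q i)"

definition network :: "nat \<Rightarrow> (nat \<Rightarrow> real ^ 2) \<Rightarrow> (nat \<Rightarrow> real ^ 2) \<Rightarrow> (real ^ 2) set" where
  "network m p q = (\<Union>i\<in>{1..m}. segment p q i)"

definition vertices :: "nat \<Rightarrow> (nat \<Rightarrow> real ^ 2) \<Rightarrow> (nat \<Rightarrow> real ^ 2) \<Rightarrow> (real ^ 2) set" where
  "vertices m p q = (\<Union>i\<in>{1..m}. {p i, q i})"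

text \<open>
  A common point of two distinct segments is an endpoint of both of them: otherwise a vertex could
  lie in the interior of a segment, and linear interpolation along that segment would be in
  conflict with the value prescribed at the vertex.
\<close>

definition linear_network :: "nat \<Rightarrow> (nat \<Rightarrow> real ^ 2) \<Rightarrow> (nat \<Rightarrow> real ^ 2) \<Rightarrow> bool" where
  "linear_network m p q \<longleftrightarrow>
     (\<forall>i\<in>{1..m}. p i \<noteq> q i) \<and>
     (\<forall>i\<in>{1..m}. \<forall>j\<in>{1..m}. i \<noteq> j \<longrightarrow>
        segment p q i \<inter> segment p q j \<subseteq> {p i, q i} \<inter> {p j, q j}) \<and>
     path_connected (network m p q)"

definition adjacent ::
  "nat \<Rightarrow> (nat \<Rightarrow> real ^ 2) \<Rightarrow> (nat \<Rightarrow> real ^ 2) \<Rightarrow> real ^ 2 \<Rightarrow> real ^ 2 \<Rightarrow> bool" where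
  "adjacent m p q x y \<longleftrightarrow> x \<noteq> y \<and> (\<exists>i\<in>{1..m}. {p i, q i} = {x, y})"

definition con ::
  "nat \<Rightarrow> (nat \<Rightarrow> real ^ 2) \<Rightarrow> (nat \<Rightarrow> real ^ 2) \<Rightarrow> real ^ 2 \<Rightarrow> real ^ 2 \<Rightarrow> real" where
  "con m p q x y = (if adjacent m p q x y then 1 / norm (x - y) else 0)"

definition total_con ::
  "nat \<Rightarrow> (nat \<Rightarrow> real ^ 2) \<Rightarrow> (nat \<Rightarrow> real ^ 2) \<Rightarrow> real ^ 2 \<Rightarrow> real" where
  "total_con m p q x = (\<Sum>y\<in>{y \<in> vertices m p q. adjacent m p q y x}. con m p q x y)"

text \<open>
  The vertices are enumerated as \<open>v i\<close> with \<open>i\<close> ranging over a finite type of size \<open>n\<close>;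
  \<open>r\<close> is the index of the reference vertex.
\<close>

definition Delta ::
  "nat \<Rightarrow> (nat \<Rightarrow> real ^ 2) \<Rightarrow> (nat \<Rightarrow> real ^ 2) \<Rightarrow> ('n::finite \<Rightarrow> real ^ 2) \<Rightarrow> 'n \<Rightarrow> real ^ 'n ^ 'n" where
  "Delta m p q v r = (\<chi> i j.
     if i = j then (if i = r then 1 + total_con m p q (v i) else total_con m p q (v i))
     else - con m p q (v i) (v j))"

section \<open>Gaussian processes\<close>

text \<open>The normal distribution with mean \<open>\<mu>\<close> and variance \<open>\<tau>\<close>, a point mass if \<open>\<tau> = 0\<close>.\<close>

definition normal_law :: "real \<Rightarrow> real \<Rightarrow> real measure" where
  "normal_law \<mu> \<tau> =
     (if \<tau> = 0 then return borel \<mu> else density lborel (\<lambda>x. ennreal (normal_density \<mu> (sqrt \<tau>) x)))"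

text \<open>
  \<open>(Y i)\<close>, \<open>i \<in> I\<close>, with \<open>I\<close> finite, is multivariate normal with mean vector \<open>\<mu>\<close> and covariance
  matrix \<open>K\<close>, which may be singular: every linear combination has the matching univariate
  normal distribution.
\<close>

definition multivariate_normal ::
  "'w measure \<Rightarrow> 'i set \<Rightarrow> ('i \<Rightarrow> 'w \<Rightarrow> real) \<Rightarrow> ('i \<Rightarrow> real) \<Rightarrow> ('i \<Rightarrow> 'i \<Rightarrow> real) \<Rightarrow> bool" where
  "multivariate_normal M I Y \<mu> K \<longleftrightarrow>
     (\<forall>i\<in>I. Y i \<in> borel_measurable M) \<and>
     (\<forall>u::'i \<Rightarrow> real. distr M borel (\<lambda>\<omega>. \<Sum>i\<in>I. u i * Y i \<omega>) =
        normal_law (\<Sum>i\<in>I. u i * \<mu> i) (\<Sum>i\<in>I. \<Sum>j\<in>I. u i * u j * K i j))"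

definition brownian_bridge :: "'w measure \<Rightarrow> real \<Rightarrow> (real \<Rightarrow> 'w \<Rightarrow> real) \<Rightarrow> bool" where
  "brownian_bridge M len B \<longleftrightarrow>
     (\<forall>T. finite T \<and> T \<subseteq> {0..len} \<longrightarrow>
        multivariate_normal M T B (\<lambda>_. 0) (\<lambda>x y. min x y - x * y / len)) \<and>
     (AE \<omega> in M. B 0 \<omega> = 0 \<and> B len \<omega> = 0 \<and> continuous_on {0..len} (\<lambda>x. B x \<omega>))"

section \<open>The auxiliary field and the resistance metric\<close>

definition field_map ::
  "'s set \<Rightarrow> ('s \<Rightarrow> 'w \<Rightarrow> real) \<Rightarrow> 'w \<Rightarrow> 's \<Rightarrow> real" where
  "field_map L Y \<omega> = (\<lambda>s\<in>L. Y s \<omega>)"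

text \<open>
  \<open>C 0, \<dots>, C m\<close> are the fields \<open>A\<^sub>0, \<dots>, A\<^sub>m\<close>. Since \<open>C i\<close> and the bridge \<open>B i\<close>
  determine each other, independence of the bridges among themselves and from \<open>C 0\<close> is the
  independence of \<open>C 0, \<dots>, C m\<close>.
\<close>

definition auxiliary_field ::
  "'w measure \<Rightarrow> nat \<Rightarrow> (nat \<Rightarrow> real ^ 2) \<Rightarrow> (nat \<Rightarrow> real ^ 2) \<Rightarrow> ('n::finite \<Rightarrow> real ^ 2) \<Rightarrow> 'n \<Rightarrow>
     (real ^ 2 \<Rightarrow> 'w \<Rightarrow> real) \<Rightarrow> bool" where
  "auxiliary_field M m p q v r A \<longleftrightarrow>
     (\<exists>(C :: nat \<Rightarrow> real ^ 2 \<Rightarrow> 'w \<Rightarrow> real) (B :: nat \<Rightarrow> real \<Rightarrow> 'w \<Rightarrow> real).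
        (\<forall>s\<in>network m p q. \<forall>\<omega>\<in>space M. A s \<omega> = C 0 s \<omega> + (\<Sum>i=1..m. C i s \<omega>)) \<and>
        prob_space.indep_vars M (\<lambda>_. PiM (network m p q) (\<lambda>_. borel))
          (\<lambda>i. field_map (network m p q) (C i)) {0..m} \<and>
        multivariate_normal M UNIV (\<lambda>i. C 0 (v i)) (\<lambda>_. 0)
          (\<lambda>i j. matrix_inv (Delta m p q v r) $ i $ j) \<and>
        (\<forall>i\<in>{1..m}. \<forall>\<omega>\<in>space M. \<forall>x\<in>{0..1}.
           C 0 ((1 - x) *\<^sub>R p i + x *\<^sub>R q i) \<omega> = (1 - x) * C 0 (p i) \<omega> + x * C 0 (q i) \<omega>) \<and>
        (\<forall>i\<in>{1..m}. brownian_bridge M (dist (p i) (q i)) (B i)) \<and>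
        (\<forall>i\<in>{1..m}. \<forall>s\<in>network m p q. \<forall>\<omega>\<in>space M.
           C i s \<omega> = (if s \<in> segment p q i then B i (dist (p i) s) \<omega> else 0)))"

definition resistance_metric ::
  "'w measure \<Rightarrow> ('s \<Rightarrow> 'w \<Rightarrow> real) \<Rightarrow> 's \<Rightarrow> 's \<Rightarrow> real" where
  "resistance_metric M A s t = prob_space.variance M (\<lambda>\<omega>. A s \<omega> - A t \<omega>)"

section \<open>Covariance and mutual independence\<close>

definition covariance :: "'w measure \<Rightarrow> ('w \<Rightarrow> real) \<Rightarrow> ('w \<Rightarrow> real) \<Rightarrow> real" where
  "covariance M X Y =
     (\<integral>\<omega>. (X \<omega> - (\<integral>\<omega>'. X \<omega>' \<partial>M)) * (Y \<omega> - (\<integral>\<omega>'. Y \<omega>' \<partial>M)) \<partial>M)"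

text \<open>
  The events generated by a random element with values in \<open>N\<close>, as in the definition of
  \<open>indep_vars\<close>; that constant itself does not apply to variables with values in different types.
\<close>

definition generated_events :: "'w measure \<Rightarrow> 'x measure \<Rightarrow> ('w \<Rightarrow> 'x) \<Rightarrow> 'w set set" where
  "generated_events M N X = {X -` S \<inter> space M | S. S \<in> sets N}"

end

theory Submission
  imports Defs
begin

text \<open>
  Since \<open>\<epsilon>\<close> has zero mean, unit variance and is independent of the rest, only
  \<open>E[K s * K t]\<close> matters, where \<open>X s = \<epsilon> * K s\<close>. Integrating out \<open>Z\<close> cancels \<open>g\<close> and
  convolves two normal densities, which leaves, with \<open>\<alpha> = \<alpha> s t\<close>,
  \<open>sqrt (b s * b t) / sqrt \<alpha> * exp (- W * (A s - A t)\<^sup>2 / (2 * \<alpha>))\<close>.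
  The increment \<open>A s - A t\<close> is centered Gaussian with variance \<open>d\<^sub>R\<close>, being a sum of independent
  centered Gaussians, so integrating it out for fixed \<open>W = w\<close> turns the exponential into
  \<open>1 / sqrt (1 + d\<^sub>R * w / \<alpha>)\<close>; integrating over \<open>W\<close> gives the claim.
\<close>

section \<open>Centered Gaussian variables\<close>

text \<open>Since \<open>sqrt \<tau> = - sqrt (- \<tau>)\<close> for negative \<open>\<tau>\<close>, the junk value \<open>normal_law 0 \<tau>\<close> is the
  normal law with variance \<open>- \<tau>\<close>.\<close>

lemma normal_density_sqrt_abs: "normal_density \<mu> (sqrt \<tau>) = normal_density \<mu> (sqrt \<bar>\<tau>\<bar>)"
proof -
  have "(sqrt \<tau>)\<^sup>2 = \<bar>\<tau>\<bar>"
    by (metis abs_ge_zero power2_minus real_sqrt_minus real_sqrt_pow2 abs_if)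
  then show ?thesis
    by (simp add: normal_density_def fun_eq_iff)
qed

text \<open>Scaling one standard normal variable also yields the point mass at
  \<open>\<tau> = 0\<close>, so later arguments need no separate degenerate case.\<close>

lemma normal_law_eq_distr:
  "normal_law 0 \<tau> = distr std_normal_distribution borel (\<lambda>x. sqrt \<bar>\<tau>\<bar> * x)"
proof (cases "\<tau> = 0")
  case True
  interpret prob_space std_normal_distribution
    by (rule prob_space_normal_density) simp
  show ?thesis using True by (simp add: normal_law_def)
next
  case False
  interpret prob_space std_normal_distribution
    by (rule prob_space_normal_density) simp
  \<comment> \<open>On the standard normal space the identity is itself a standard normal variable;
    the affine rule then rescales it.\<close>
  have "distributed std_normal_distribution lborel (\<lambda>x. x) std_normal_density"
    by (simp add: distributed_def distr_id2)
  from normal_density_affine[OF this, of "sqrt \<bar>\<tau>\<bar>" 0] False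
  have "distributed std_normal_distribution lborel (\<lambda>x. sqrt \<bar>\<tau>\<bar> * x) (normal_density 0 (sqrt \<bar>\<tau>\<bar>))"
    by simp
  then have "distr std_normal_distribution lborel (\<lambda>x. sqrt \<bar>\<tau>\<bar> * x)
      = density lborel (normal_density 0 (sqrt \<bar>\<tau>\<bar>))"
    by (simp add: distributed_def)
  also have "distr std_normal_distribution lborel (\<lambda>x. sqrt \<bar>\<tau>\<bar> * x)
      = distr std_normal_distribution borel (\<lambda>x. sqrt \<bar>\<tau>\<bar> * x)"
    by (intro distr_cong) auto
  finally show ?thesis
    using False by (simp add: normal_law_def normal_density_sqrt_abs[of 0 \<tau>])
qed

lemma normal_law_abs: "normal_law 0 \<bar>\<tau>\<bar> = normal_law 0 \<tau>"
  by (simp add: normal_law_eq_distr)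

lemma real_distribution_normal_law: "real_distribution (normal_law 0 \<tau>)"
proof -
  interpret prob_space std_normal_distribution
    by (rule prob_space_normal_density) simp
  show ?thesis
    unfolding normal_law_eq_distr by (rule real_distribution_distr) simp
qed

lemma char_normal_law: "char (normal_law 0 \<tau>) t = exp (- \<bar>\<tau>\<bar> * t\<^sup>2 / 2)"
proof -
  have "char (normal_law 0 \<tau>) t = char std_normal_distribution (sqrt \<bar>\<tau>\<bar> * t)"
    unfolding normal_law_eq_distr char_def
    by (subst integral_distr) (auto simp: mult_ac)
  then show ?thesis
    by (simp add: char_std_normal_distribution power_mult_distrib)
qed

text \<open>The variance stays existential: increments only have to be shown Gaussian, and their
  variance is the resistance metric by definition of the latter. Variance zero is allowed, as for an
  increment with \<open>s = t\<close>.\<close>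

definition centered_gaussian :: "'w measure \<Rightarrow> ('w \<Rightarrow> real) \<Rightarrow> bool" where
  "centered_gaussian M Y \<longleftrightarrow>
     Y \<in> borel_measurable M \<and> (\<exists>\<tau>\<ge>0. distr M borel Y = normal_law 0 \<tau>)"

text \<open>The sign of \<open>\<tau>\<close> is free, so a quadratic form can serve as variance
  without a proof that its matrix is positive semidefinite.\<close>

lemma centered_gaussianI:
  assumes "Y \<in> borel_measurable M" "distr M borel Y = normal_law 0 \<tau>"
  shows "centered_gaussian M Y"
  using assms unfolding centered_gaussian_def
  by (intro conjI exI[of _ "\<bar>\<tau>\<bar>"]) (auto simp: normal_law_abs)

lemma centered_gaussian_cong:
  assumes "\<And>\<omega>. \<omega> \<in> space M \<Longrightarrow> Y \<omega> = Y' \<omega>"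
  shows "centered_gaussian M Y \<longleftrightarrow> centered_gaussian M Y'"
proof -
  have "distr M borel Y = distr M borel Y'"
    by (intro distr_cong assms) auto
  with assms show ?thesis
    by (simp add: centered_gaussian_def cong: measurable_cong)
qed

lemma centered_gaussian_linear_combination:
  assumes "multivariate_normal M I Y (\<lambda>_. 0) K"
  shows "centered_gaussian M (\<lambda>\<omega>. \<Sum>i\<in>I. u i * Y i \<omega>)"
proof (rule centered_gaussianI)
  show "(\<lambda>\<omega>. \<Sum>i\<in>I. u i * Y i \<omega>) \<in> borel_measurable M"
    using assms unfolding multivariate_normal_def
    by (intro borel_measurable_sum borel_measurable_times) auto
  show "distr M borel (\<lambda>\<omega>. \<Sum>i\<in>I. u i * Y i \<omega>)
      = normal_law 0 (\<Sum>i\<in>I. \<Sum>j\<in>I. u i * u j * K i j)"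
    using assms by (simp add: multivariate_normal_def)
qed

text \<open>Characteristic functions multiply under independence, the exponents add, and Levy's
  uniqueness theorem identifies the law.\<close>

lemma (in prob_space) centered_gaussian_sum:
  assumes indep: "indep_vars (\<lambda>_. borel) Y I"
    and Y: "\<And>i. i \<in> I \<Longrightarrow> centered_gaussian M (Y i)"
  shows "centered_gaussian M (\<lambda>\<omega>. \<Sum>i\<in>I. Y i \<omega>)"
proof -
  obtain \<tau> where \<tau>: "\<And>i. i \<in> I \<Longrightarrow> \<tau> i \<ge> 0 \<and> distr M borel (Y i) = normal_law 0 (\<tau> i)"
    using Y unfolding centered_gaussian_def by metis
  have meas: "(\<lambda>\<omega>. \<Sum>i\<in>I. Y i \<omega>) \<in> borel_measurable M"
    using Y by (intro borel_measurable_sum) (auto simp: centered_gaussian_def)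
  have "char (distr M borel (\<lambda>\<omega>. \<Sum>i\<in>I. Y i \<omega>)) t = char (normal_law 0 (\<Sum>i\<in>I. \<tau> i)) t" for t
  proof -
    \<comment> \<open>\<open>char_normal_law\<close> involves the absolute value of the variance;
      nonnegativity makes it additive.\<close>
    have "(\<Sum>i\<in>I. \<tau> i) \<ge> 0"
      using \<tau> by (intro sum_nonneg) auto
    have "char (distr M borel (\<lambda>\<omega>. \<Sum>i\<in>I. Y i \<omega>)) t = (\<Prod>i\<in>I. char (distr M borel (Y i)) t)"
      by (rule char_distr_sum[OF indep])
    also have "\<dots> = (\<Prod>i\<in>I. complex_of_real (exp (- \<tau> i * t\<^sup>2 / 2)))"
      using \<tau> by (intro prod.cong) (auto simp: char_normal_law)
    also have "\<dots> = of_real (\<Prod>i\<in>I. exp (- \<tau> i * t\<^sup>2 / 2))"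
      by (simp only: of_real_prod)
    \<comment> \<open>For infinite \<open>I\<close> the product is 1 and the sum is 0 by default, so
      the two sides still agree.\<close>
    also have "(\<Prod>i\<in>I. exp (- \<tau> i * t\<^sup>2 / 2)) = exp (\<Sum>i\<in>I. - \<tau> i * t\<^sup>2 / 2)"
      by (cases "finite I") (simp_all add: exp_sum)
    also have "(\<Sum>i\<in>I. - \<tau> i * t\<^sup>2 / 2) = - (\<Sum>i\<in>I. \<tau> i) * t\<^sup>2 / 2"
      by (simp add: sum_negf sum_distrib_right sum_divide_distrib)
    finally show ?thesis
      using \<open>(\<Sum>i\<in>I. \<tau> i) \<ge> 0\<close> by (simp add: char_normal_law)
  qed
  then have "distr M borel (\<lambda>\<omega>. \<Sum>i\<in>I. Y i \<omega>) = normal_law 0 (\<Sum>i\<in>I. \<tau> i)"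
    by (intro Levy_uniqueness real_distribution_distr meas real_distribution_normal_law) auto
  with meas show ?thesis
    by (rule centered_gaussianI)
qed

text \<open>This identifies the parameter of an increment's law with the resistance metric. It
  reduces to the first two moments of the standard normal law.\<close>

lemma (in prob_space) centered_gaussian_variance:
  assumes "Y \<in> borel_measurable M" "distr M borel Y = normal_law 0 \<tau>" "\<tau> \<ge> 0"
  shows "variance Y = \<tau>"
proof -
  have int: "expectation (\<lambda>\<omega>. h (Y \<omega>)) = (\<integral>x. h (sqrt \<tau> * x) \<partial>std_normal_distribution)"
    if "h \<in> borel_measurable borel" for h :: "real \<Rightarrow> real"
  proof -
    have "expectation (\<lambda>\<omega>. h (Y \<omega>)) = (\<integral>y. h y \<partial>normal_law 0 \<tau>)"
      using that assms by (simp flip: assms(2) add: integral_distr)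
    then show ?thesis
      using that assms(3) by (simp add: normal_law_eq_distr integral_distr)
  qed
  have "expectation Y = sqrt \<tau> * (\<integral>x. x \<partial>std_normal_distribution)"
    using int[of "\<lambda>x. x"] by simp
  also have "(\<integral>x. x \<partial>std_normal_distribution) = 0"
    using integral_std_normal_moment_odd[of 0] by (simp add: integral_density)
  finally have mean: "expectation Y = 0" by simp
  have "variance Y = expectation (\<lambda>\<omega>. (Y \<omega>)\<^sup>2)"
    using mean by simp
  also have "\<dots> = \<tau> * (\<integral>x. x\<^sup>2 \<partial>std_normal_distribution)"
    using int[of "\<lambda>x. x\<^sup>2"] assms(3) by (simp add: power_mult_distrib)
  also have "(\<integral>x. x\<^sup>2 \<partial>std_normal_distribution) = (1 :: real)"
    using integral_std_normal_moment_even[of 1] by (simp add: integral_density fact_numeral)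
  finally show ?thesis by simp
qed

section \<open>Gaussian integrals\<close>

text \<open>The factor \<open>exp (- k * x\<^sup>2)\<close> turns the standard normal density into a
  constant multiple of another centered normal density.\<close>

lemma nn_integral_exp_std_normal:
  assumes "k \<ge> 0"
  shows "(\<integral>\<^sup>+x. ennreal (exp (- k * x\<^sup>2)) \<partial>std_normal_distribution) = ennreal (1 / sqrt (1 + 2 * k))"
proof -
  \<comment> \<open>Matching exponents requires
    \<open>1 / 2 + k = 1 / (2 * \<sigma>\<^sup>2)\<close>; the leftover constant is then
    \<open>\<sigma>\<close> as well.\<close>
  define \<sigma> where "\<sigma> = 1 / sqrt (1 + 2 * k)"
  have \<sigma>: "\<sigma> > 0" "\<sigma>\<^sup>2 = 1 / (1 + 2 * k)"
    using assms by (auto simp: \<sigma>_def power_divide)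
  interpret N: prob_space "density lborel (normal_density 0 \<sigma>)"
    by (rule prob_space_normal_density) fact
  have eq: "std_normal_density x * exp (- (k * x\<^sup>2)) = \<sigma> * normal_density 0 \<sigma> x" for x
  proof -
    have "- x\<^sup>2 / 2 + - (k * x\<^sup>2) = - x\<^sup>2 / (2 * \<sigma>\<^sup>2)"
      using assms by (simp add: \<sigma> field_simps)
    then show ?thesis
      using \<sigma>(1) by (simp add: normal_density_def real_sqrt_mult mult_exp_exp)
  qed
  have "(\<integral>\<^sup>+x. ennreal (exp (- k * x\<^sup>2)) \<partial>std_normal_distribution)
      = (\<integral>\<^sup>+x. ennreal (\<sigma>) * ennreal (normal_density 0 \<sigma> x) \<partial>lborel)"
    using \<sigma>(1)
    by (subst nn_integral_density)
       (auto intro!: nn_integral_cong simp: eq ennreal_mult''[symmetric] ennreal_mult'[symmetric])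
  also have "\<dots> = ennreal \<sigma> * (\<integral>\<^sup>+x. ennreal (normal_density 0 \<sigma> x) \<partial>lborel)"
    by (intro nn_integral_cmult) simp
  also have "(\<integral>\<^sup>+x. ennreal (normal_density 0 \<sigma> x) \<partial>lborel) = 1"
    using N.emeasure_space_1 by (simp add: emeasure_density)
  finally show ?thesis by (simp add: \<sigma>_def)
qed

lemma nn_integral_exp_gaussian:
  assumes Y: "Y \<in> borel_measurable M" "distr M borel Y = normal_law 0 \<tau>" "\<tau> \<ge> 0" and "k \<ge> 0"
  shows "(\<integral>\<^sup>+\<omega>. ennreal (exp (- k * (Y \<omega>)\<^sup>2)) \<partial>M) = ennreal (1 / sqrt (1 + 2 * k * \<tau>))"
proof -
  have "(\<integral>\<^sup>+\<omega>. ennreal (exp (- k * (Y \<omega>)\<^sup>2)) \<partial>M)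
      = (\<integral>\<^sup>+y. ennreal (exp (- k * y\<^sup>2)) \<partial>distr M borel Y)"
    using Y(1) by (simp add: nn_integral_distr)
  also have "\<dots> = (\<integral>\<^sup>+x. ennreal (exp (- (k * \<tau>) * x\<^sup>2)) \<partial>std_normal_distribution)"
    using Y(3) by (simp add: Y(2) normal_law_eq_distr nn_integral_distr power_mult_distrib mult_ac)
  finally show ?thesis
    using nn_integral_exp_std_normal[of "k * \<tau>"] assms by (simp add: mult.assoc)
qed

text \<open>After a shift by \<open>\<nu>\<close> the integral is a convolution of two centered
  normal densities, evaluated at the difference of the means, so the variances add.\<close>

lemma nn_integral_normal_density_mult:
  assumes "\<sigma> > 0" "\<tau> > 0"
  shows "(\<integral>\<^sup>+z. ennreal (normal_density \<mu> \<sigma> z * normal_density \<nu> \<tau> z) \<partial>lborel)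
    = ennreal (normal_density 0 (sqrt (\<sigma>\<^sup>2 + \<tau>\<^sup>2)) (\<mu> - \<nu>))"
proof -
  have "(\<integral>\<^sup>+z. ennreal (normal_density \<mu> \<sigma> z * normal_density \<nu> \<tau> z) \<partial>lborel)
      = (\<integral>\<^sup>+y. ennreal (normal_density \<mu> \<sigma> (\<nu> + y) * normal_density \<nu> \<tau> (\<nu> + y)) \<partial>lborel)"
    by (subst nn_integral_real_affine[where c = 1 and t = \<nu>]) auto
  \<comment> \<open>Evenness of the centered density replaces \<open>\<nu> + y - \<mu>\<close> by
    \<open>\<mu> - \<nu> - y\<close>, the argument that a convolution requires.\<close>
  also have "\<dots> = (\<integral>\<^sup>+y. ennreal (normal_density 0 \<sigma> (\<mu> - \<nu> - y) * normal_density 0 \<tau> y) \<partial>lborel)"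
    by (simp add: normal_density_def power2_commute diff_diff_eq)
  also have "\<dots> = ennreal (normal_density 0 (sqrt (\<sigma>\<^sup>2 + \<tau>\<^sup>2)) (\<mu> - \<nu>))"
    using conv_normal_density_zero_mean[OF assms] by (rule fun_cong)
  finally show ?thesis .
qed

section \<open>Increments of the auxiliary field\<close>

text \<open>The weights \<open>u\<close> have to be the same for all \<open>\<omega>\<close>: only
  then does joint normality at the vertices carry over to interior points of the segments.\<close>

lemma interpolated_field:
  assumes "bij_betw v UNIV (vertices m p q)"
    and "\<forall>i\<in>{1..m}. \<forall>\<omega>\<in>\<Omega>. \<forall>x\<in>{0..1}.
      Y ((1 - x) *\<^sub>R p i + x *\<^sub>R q i) \<omega> = (1 - x) * Y (p i) \<omega> + x * Y (q i) \<omega>"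
    and "s \<in> network m p q"
  obtains u :: "'n::finite \<Rightarrow> real" where "\<And>\<omega>. \<omega> \<in> \<Omega> \<Longrightarrow> Y s \<omega> = (\<Sum>k\<in>UNIV. u k * Y (v k) \<omega>)"
proof -
  obtain i where i: "i \<in> {1..m}" "s \<in> closed_segment (p i) (q i)"
    using assms(3) by (auto simp: network_def segment_def)
  then obtain x where x: "x \<in> {0..1}" "s = (1 - x) *\<^sub>R p i + x *\<^sub>R q i"
    by (auto simp: closed_segment_def)
  have "p i \<in> range v" "q i \<in> range v"
    using assms(1) i(1) by (auto simp: bij_betw_def vertices_def)
  then obtain j k where jk: "p i = v j" "q i = v k" by blast
  have sum1: "(\<Sum>l\<in>UNIV. (if l = j then y else 0) * Y (v l) \<omega>) = y * Y (v j) \<omega>" for y j \<omega>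
    by (simp add: if_distrib[of "\<lambda>c. c * _"] cong: if_cong)
  show ?thesis
  \<comment> \<open>The two indicator terms are added rather than nested, which also covers
    \<open>j = k\<close>.\<close>
  proof (rule that[of "\<lambda>l. (if l = j then 1 - x else 0) + (if l = k then x else 0)"])
    fix \<omega> assume "\<omega> \<in> \<Omega>"
    then have "Y s \<omega> = (1 - x) * Y (p i) \<omega> + x * Y (q i) \<omega>"
      unfolding x(2) using assms(2) i(1) x(1) by blast
    then have "Y s \<omega> = (1 - x) * Y (v j) \<omega> + x * Y (v k) \<omega>"
      by (simp only: jk)
    then show "Y s \<omega> = (\<Sum>l\<in>UNIV. ((if l = j then 1 - x else 0) + (if l = k then x else 0)) * Y (v l) \<omega>)"
      by (simp only: distrib_right sum.distrib sum1)
  qed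
qed

lemma interpolated_field_diff_gaussian:
  fixes v :: "'n::finite \<Rightarrow> real ^ 2"
  assumes v: "bij_betw v UNIV (vertices m p q)"
    and normal: "multivariate_normal M UNIV (\<lambda>i. Y (v i)) (\<lambda>_. 0) K"
    and lin: "\<forall>i\<in>{1..m}. \<forall>\<omega>\<in>space M. \<forall>x\<in>{0..1}.
      Y ((1 - x) *\<^sub>R p i + x *\<^sub>R q i) \<omega> = (1 - x) * Y (p i) \<omega> + x * Y (q i) \<omega>"
    and st: "s \<in> network m p q" "t \<in> network m p q"
  shows "centered_gaussian M (\<lambda>\<omega>. Y s \<omega> - Y t \<omega>)"
proof -
  obtain u where u: "\<And>\<omega>. \<omega> \<in> space M \<Longrightarrow> Y s \<omega> = (\<Sum>k\<in>UNIV. u k * Y (v k) \<omega>)"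
    using interpolated_field[OF v lin st(1)] by metis
  obtain u' where u': "\<And>\<omega>. \<omega> \<in> space M \<Longrightarrow> Y t \<omega> = (\<Sum>k\<in>UNIV. u' k * Y (v k) \<omega>)"
    using interpolated_field[OF v lin st(2)] by metis
  have "Y s \<omega> - Y t \<omega> = (\<Sum>k\<in>UNIV. (u k - u' k) * Y (v k) \<omega>)" if "\<omega> \<in> space M" for \<omega>
    using u u' that by (simp add: left_diff_distrib sum_subtractf)
  then show ?thesis
    using centered_gaussian_linear_combination[OF normal, of "\<lambda>k. u k - u' k"]
    by (simp cong: centered_gaussian_cong)
qed

text \<open>The increment is a linear combination of at most two bridge values, so joint normality
  of the bridge at finitely many times suffices.\<close>

lemma bridge_field_diff_gaussian:
  fixes x y :: "'a::euclidean_space"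
  assumes B: "brownian_bridge M (dist x y) B"
    and Y: "\<And>s \<omega>. s \<in> L \<Longrightarrow> \<omega> \<in> space M \<Longrightarrow>
      Y s \<omega> = (if s \<in> closed_segment x y then B (dist x s) \<omega> else 0)"
    and st: "s \<in> L" "t \<in> L"
  shows "centered_gaussian M (\<lambda>\<omega>. Y s \<omega> - Y t \<omega>)"
proof -
  \<comment> \<open>As a set of times, \<open>T\<close> merges coinciding times and drops points off
    the segment. It may be empty; the empty combination has the point mass at 0 as its law.\<close>
  define T where "T = dist x ` ({s, t} \<inter> closed_segment x y)"
  define u where "u s' r = (if s' \<in> closed_segment x y \<and> r = dist x s' then 1 else 0 :: real)" for s' r
  have "dist x s' \<le> dist x y" if "s' \<in> closed_segment x y" for s'
    using dist_in_closed_segment[OF that] by (simp add: dist_commute)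
  then have T: "finite T" "T \<subseteq> {0..dist x y}"
    by (auto simp: T_def)
  have u: "Y s' \<omega> = (\<Sum>r\<in>T. u s' r * B r \<omega>)" if "s' \<in> {s, t}" "\<omega> \<in> space M" for s' \<omega>
  proof (cases "s' \<in> closed_segment x y")
    case True
    then have "dist x s' \<in> T" using that by (auto simp: T_def)
    then show ?thesis
      using True that st T(1) Y
      by (auto simp: u_def if_distrib[of "\<lambda>c. c * _"] cong: if_cong)
  qed (use that st Y in \<open>auto simp: u_def\<close>)
  have "multivariate_normal M T B (\<lambda>_. 0) (\<lambda>r r'. min r r' - r * r' / dist x y)"
    using B T by (simp add: brownian_bridge_def)
  from centered_gaussian_linear_combination[OF this, of "\<lambda>r. u s r - u t r"]
  show ?thesis
    by (simp add: u left_diff_distrib sum_subtractf cong: centered_gaussian_cong)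
qed

text \<open>Independence of the component fields includes that they are random elements of the
  product space, and evaluation at \<open>s\<close> is a coordinate projection of it.\<close>

lemma auxiliary_field_measurable:
  assumes "prob_space M" "auxiliary_field M m p q v r A" "s \<in> network m p q"
  shows "A s \<in> borel_measurable M"
proof -
  interpret prob_space M by fact
  obtain C where A: "\<forall>s\<in>network m p q. \<forall>\<omega>\<in>space M. A s \<omega> = C 0 s \<omega> + (\<Sum>i=1..m. C i s \<omega>)"
    and C: "indep_vars (\<lambda>_. PiM (network m p q) (\<lambda>_. borel)) (\<lambda>i. field_map (network m p q) (C i)) {0..m}"
    using assms(2) unfolding auxiliary_field_def by blast
  have "C i s \<in> borel_measurable M" if "i \<in> {0..m}" for i
  proof -
    have "field_map (network m p q) (C i) \<in> measurable M (PiM (network m p q) (\<lambda>_. borel))"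
      using C that by (simp add: indep_vars_def)
    from measurable_compose[OF this measurable_component_singleton[OF assms(3)]]
    show ?thesis using assms(3) by (simp add: field_map_def)
  qed
  then have "(\<lambda>\<omega>. C 0 s \<omega> + (\<Sum>i=1..m. C i s \<omega>)) \<in> borel_measurable M"
    by (intro borel_measurable_add borel_measurable_sum) auto
  then show ?thesis
    using A assms(3) by (simp cong: measurable_cong)
qed

text \<open>Each component increment is a function of its own component field alone, so the
  increments inherit independence, and Gaussianity passes to their sum.\<close>

lemma auxiliary_field_diff_gaussian:
  assumes "prob_space M" and v: "bij_betw v UNIV (vertices m p q)"
    and aux: "auxiliary_field M m p q v r A"
    and st: "s \<in> network m p q" "t \<in> network m p q"
  shows "centered_gaussian M (\<lambda>\<omega>. A s \<omega> - A t \<omega>)"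
proof -
  interpret prob_space M by fact
  define L where "L = network m p q"
  obtain C B where A: "\<forall>s\<in>L. \<forall>\<omega>\<in>space M. A s \<omega> = C 0 s \<omega> + (\<Sum>i=1..m. C i s \<omega>)"
    and C: "indep_vars (\<lambda>_. PiM L (\<lambda>_. borel)) (\<lambda>i. field_map L (C i)) {0..m}"
    and normal: "multivariate_normal M UNIV (\<lambda>i. C 0 (v i)) (\<lambda>_. 0) (\<lambda>i j. matrix_inv (Delta m p q v r) $ i $ j)"
    and lin: "\<forall>i\<in>{1..m}. \<forall>\<omega>\<in>space M. \<forall>x\<in>{0..1}.
      C 0 ((1 - x) *\<^sub>R p i + x *\<^sub>R q i) \<omega> = (1 - x) * C 0 (p i) \<omega> + x * C 0 (q i) \<omega>"
    and B: "\<forall>i\<in>{1..m}. brownian_bridge M (dist (p i) (q i)) (B i)"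
    and CB: "\<forall>i\<in>{1..m}. \<forall>s\<in>L. \<forall>\<omega>\<in>space M. C i s \<omega> = (if s \<in> segment p q i then B i (dist (p i) s) \<omega> else 0)"
    using aux unfolding auxiliary_field_def L_def[symmetric] by blast
  have st': "s \<in> L" "t \<in> L" using st by (auto simp: L_def)
  have "indep_vars (\<lambda>_. borel) (\<lambda>i \<omega>. field_map L (C i) \<omega> s - field_map L (C i) \<omega> t) {0..m}"
    using st' by (intro indep_vars_compose2[OF C]) measurable
  then have "indep_vars (\<lambda>_. borel) (\<lambda>i \<omega>. C i s \<omega> - C i t \<omega>) {0..m}"
    using st' by (simp add: field_map_def)
  then have "centered_gaussian M (\<lambda>\<omega>. \<Sum>i\<in>{0..m}. C i s \<omega> - C i t \<omega>)"
  proof (rule centered_gaussian_sum)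
    fix i assume "i \<in> {0..m}"
    then consider "i = 0" | "i \<in> {1..m}" by fastforce
    then show "centered_gaussian M (\<lambda>\<omega>. C i s \<omega> - C i t \<omega>)"
    proof cases
      case 1
      then show ?thesis
        using interpolated_field_diff_gaussian[OF v normal lin st] by simp
    next
      case 2
      then show ?thesis
        using bridge_field_diff_gaussian[where x = "p i" and y = "q i" and B = "B i" and L = L] B CB st'
        by (simp add: segment_def)
    qed
  qed
  moreover have "A s \<omega> - A t \<omega> = (\<Sum>i\<in>{0..m}. C i s \<omega> - C i t \<omega>)" if "\<omega> \<in> space M" for \<omega>
    using A that st' by (simp add: sum.atLeast_Suc_atMost[of 0 m] sum_subtractf)
  ultimately show ?thesis
    by (simp cong: centered_gaussian_cong)
qed

section \<open>Mixing over independent sources\<close>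

text \<open>Disjoint blocks of an independent family have a product law, so Tonelli allows block
  \<open>A\<close> to be integrated out with block \<open>B\<close> frozen.\<close>

lemma (in prob_space) nn_integral_indep_restrict:
  assumes ind: "indep_vars M' X I" "A \<inter> B = {}" "A \<subseteq> I" "B \<subseteq> I"
    and H: "H \<in> borel_measurable (PiM A M' \<Otimes>\<^sub>M PiM B M')"
  shows "(\<integral>\<^sup>+\<omega>. H (\<lambda>i\<in>A. X i \<omega>, \<lambda>i\<in>B. X i \<omega>) \<partial>M)
    = (\<integral>\<^sup>+\<omega>. (\<integral>\<^sup>+\<omega>'. H (\<lambda>i\<in>A. X i \<omega>', \<lambda>i\<in>B. X i \<omega>) \<partial>M) \<partial>M)"
proof -
  let ?XA = "\<lambda>\<omega>. \<lambda>i\<in>A. X i \<omega>" and ?XB = "\<lambda>\<omega>. \<lambda>i\<in>B. X i \<omega>"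
  have iv: "indep_var (PiM A M') ?XA (PiM B M') ?XB"
    by (rule indep_var_restrict) fact+
  then have XA [measurable]: "?XA \<in> measurable M (PiM A M')"
    and XB [measurable]: "?XB \<in> measurable M (PiM B M')"
    and eq: "distr M (PiM A M') ?XA \<Otimes>\<^sub>M distr M (PiM B M') ?XB
      = distr M (PiM A M' \<Otimes>\<^sub>M PiM B M') (\<lambda>\<omega>. (?XA \<omega>, ?XB \<omega>))"
    by (auto simp: indep_var_distribution_eq)
  note H[measurable]
  interpret PA: prob_space "distr M (PiM A M') ?XA" by (rule prob_space_distr) fact
  interpret PB: prob_space "distr M (PiM B M') ?XB" by (rule prob_space_distr) fact
  interpret AB: pair_sigma_finite "distr M (PiM A M') ?XA" "distr M (PiM B M') ?XB" ..
  have "(\<integral>\<^sup>+\<omega>. H (?XA \<omega>, ?XB \<omega>) \<partial>M)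
      = (\<integral>\<^sup>+x. H x \<partial>(distr M (PiM A M') ?XA \<Otimes>\<^sub>M distr M (PiM B M') ?XB))"
    unfolding eq by (simp add: nn_integral_distr)
  also have "\<dots> = (\<integral>\<^sup>+y. \<integral>\<^sup>+x. H (x, y) \<partial>distr M (PiM A M') ?XA \<partial>distr M (PiM B M') ?XB)"
    by (rule AB.nn_integral_snd[symmetric]) simp
  also have "\<dots> = (\<integral>\<^sup>+\<omega>. \<integral>\<^sup>+x. H (x, ?XB \<omega>) \<partial>distr M (PiM A M') ?XA \<partial>M)"
    by (subst nn_integral_distr) measurable
  also have "\<dots> = (\<integral>\<^sup>+\<omega>. \<integral>\<^sup>+\<omega>'. H (?XA \<omega>', ?XB \<omega>) \<partial>M \<partial>M)"
  proof (rule nn_integral_cong)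
    \<comment> \<open>Freezing block \<open>B\<close> at a point of its space gives a measurable
      section, so the inner integral can be pulled back to \<open>M\<close>.\<close>
    fix \<omega> assume "\<omega> \<in> space M"
    then have "?XB \<omega> \<in> space (PiM B M')"
      by (rule measurable_space[OF XB])
    then have "(\<lambda>x. H (x, ?XB \<omega>)) \<in> borel_measurable (PiM A M')"
      by (rule measurable_compose[OF measurable_Pair2' H])
    then show "(\<integral>\<^sup>+x. H (x, ?XB \<omega>) \<partial>distr M (PiM A M') ?XA) = (\<integral>\<^sup>+\<omega>'. H (?XA \<omega>', ?XB \<omega>) \<partial>M)"
      by (simp add: nn_integral_distr)
  qed
  finally show ?thesis .
qed

section \<open>The kernel multiplying the noise\<close>

text \<open>\<open>X s = \<epsilon> * smoothing g (a s) (b s) Z W (A s)\<close>.\<close>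

definition smoothing :: "(real \<Rightarrow> real) \<Rightarrow> real \<Rightarrow> real \<Rightarrow> real \<Rightarrow> real \<Rightarrow> real \<Rightarrow> real" where
  "smoothing g a b z w y =
     sqrt (b / g z) * (pi / w) powr (1 / 4) * normal_density (y / sqrt 2) (sqrt (a / (4 * w))) z"

lemma smoothing_nonneg: "0 \<le> b \<Longrightarrow> 0 \<le> g z \<Longrightarrow> 0 \<le> smoothing g a b z w y"
  by (simp add: smoothing_def)

lemma measurable_smoothing[measurable (raw)]:
  assumes [measurable]: "g \<in> borel_measurable borel"
    "f1 \<in> borel_measurable N" "f2 \<in> borel_measurable N" "f3 \<in> borel_measurable N"
  shows "(\<lambda>x. smoothing g a b (f1 x) (f2 x) (f3 x)) \<in> borel_measurable N"
  unfolding smoothing_def normal_density_def by measurable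

text \<open>The two factors \<open>1 / sqrt (g z)\<close> cancel the density of \<open>Z\<close>.
  What remains is a product of two normal densities in \<open>z\<close>, whose integral is a normal
  density in the difference of their means.\<close>

lemma nn_integral_smoothing_mult:
  assumes [measurable]: "g \<in> borel_measurable borel"
    and g: "\<And>z. 0 \<le> g z" "AE z in lborel. 0 < g z"
    and pos: "0 < a" "0 < b" "0 < a'" "0 < b'" "0 < w"
  shows "(\<integral>\<^sup>+z. ennreal (g z) * ennreal (smoothing g a b z w y * smoothing g a' b' z w y') \<partial>lborel)
    = ennreal (sqrt (b * b') / sqrt ((a + a') / 2) * exp (- (w / (a + a')) * (y - y')\<^sup>2))"
proof -
  define \<sigma> \<sigma>' where "\<sigma> = sqrt (a / (4 * w))" and "\<sigma>' = sqrt (a' / (4 * w))"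
  have \<sigma>: "0 < \<sigma>" "0 < \<sigma>'" "\<sigma>\<^sup>2 + \<sigma>'\<^sup>2 = (a + a') / (4 * w)"
    using pos by (auto simp: \<sigma>_def \<sigma>'_def field_simps)
  \<comment> \<open>\<open>c\<close> collects the factors free of \<open>z\<close>; the two fourth
    roots combine to \<open>sqrt (pi / w)\<close>.\<close>
  define c where "c = sqrt (b * b') * sqrt (pi / w)"
  have "c \<ge> 0" using pos by (simp add: c_def)
  \<comment> \<open>Positivity of \<open>g z\<close> matters: where \<open>g z = 0\<close> the left
    side is 0 while the right side is positive. Under the integral the identity is therefore used
    almost everywhere.\<close>
  have eq: "g z * (smoothing g a b z w y * smoothing g a' b' z w y')
      = c * (normal_density (y / sqrt 2) \<sigma> z * normal_density (y' / sqrt 2) \<sigma>' z)" if "0 < g z" for z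
  proof -
    have "g z * (sqrt (b / g z) * sqrt (b' / g z)) = sqrt (b * b')"
      using that by (simp add: real_sqrt_mult real_sqrt_divide)
    moreover have "(pi / w) powr (1 / 4) * (pi / w) powr (1 / 4) = sqrt (pi / w)"
      using pos by (simp add: powr_add[symmetric] powr_half_sqrt)
    moreover have "g z * (smoothing g a b z w y * smoothing g a' b' z w y')
        = (g z * (sqrt (b / g z) * sqrt (b' / g z))) * ((pi / w) powr (1 / 4) * (pi / w) powr (1 / 4))
          * (normal_density (y / sqrt 2) \<sigma> z * normal_density (y' / sqrt 2) \<sigma>' z)"
      unfolding smoothing_def \<sigma>_def \<sigma>'_def by (simp only: mult_ac)
    ultimately show ?thesis
      by (simp only: c_def)
  qed
  have "(\<integral>\<^sup>+z. ennreal (g z) * ennreal (smoothing g a b z w y * smoothing g a' b' z w y') \<partial>lborel)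
      = (\<integral>\<^sup>+z. ennreal c * ennreal (normal_density (y / sqrt 2) \<sigma> z * normal_density (y' / sqrt 2) \<sigma>' z) \<partial>lborel)"
    using g(2) \<open>c \<ge> 0\<close>
    by (intro nn_integral_cong_AE) (auto elim!: eventually_mono simp: ennreal_mult'[symmetric] eq)
  also have "\<dots> = ennreal c * ennreal (normal_density 0 (sqrt (\<sigma>\<^sup>2 + \<sigma>'\<^sup>2)) (y / sqrt 2 - y' / sqrt 2))"
    using \<sigma> by (simp add: nn_integral_cmult nn_integral_normal_density_mult)
  also have "\<dots> = ennreal (c * normal_density 0 (sqrt (\<sigma>\<^sup>2 + \<sigma>'\<^sup>2)) (y / sqrt 2 - y' / sqrt 2))"
    using \<open>c \<ge> 0\<close> by (simp add: ennreal_mult')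
  also have "c * normal_density 0 (sqrt (\<sigma>\<^sup>2 + \<sigma>'\<^sup>2)) (y / sqrt 2 - y' / sqrt 2)
      = sqrt (b * b') / sqrt ((a + a') / 2) * exp (- (w / (a + a')) * (y - y')\<^sup>2)"
  proof -
    have "(y / sqrt 2 - y' / sqrt 2)\<^sup>2 = (y - y')\<^sup>2 / 2"
      by (simp add: diff_divide_distrib[symmetric] power_divide)
    then have e: "- (y / sqrt 2 - y' / sqrt 2)\<^sup>2 / (2 * ((a + a') / (4 * w))) = - (w / (a + a')) * (y - y')\<^sup>2"
      using pos by (simp add: field_simps)
    \<comment> \<open>This is what the power of \<open>pi / W\<close> in the field is designed for:
      \<open>pi\<close> and \<open>w\<close> drop out of the prefactor.\<close>
    have "(pi / w) / (2 * pi * ((a + a') / (4 * w))) = 1 / ((a + a') / 2)"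
      using pos by (simp add: divide_simps)
    then have "sqrt (pi / w) / sqrt (2 * pi * ((a + a') / (4 * w))) = 1 / sqrt ((a + a') / 2)"
      by (metis real_sqrt_divide real_sqrt_one)
    then have "c / sqrt (2 * pi * ((a + a') / (4 * w))) = sqrt (b * b') / sqrt ((a + a') / 2)"
      by (metis c_def times_divide_eq_right mult_1_right)
    moreover have "normal_density 0 (sqrt ((a + a') / (4 * w))) x
        = 1 / sqrt (2 * pi * ((a + a') / (4 * w))) * exp (- x\<^sup>2 / (2 * ((a + a') / (4 * w))))" for x
      using pos by (simp add: normal_density_def)
    moreover have "c * (1 / r * E) = c / r * E" for r E
      by simp
    ultimately show ?thesis
      by (simp only: \<sigma>(3) e)
  qed
  finally show ?thesis .
qed

section \<open>Splitting expectations over the four independent sources\<close>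

text \<open>
  The four independent sources are padded to the common type \<^typ>\<open>real \<times> real\<close>, so that
  \<^const>\<open>prob_space.indep_vars\<close> and its grouping lemmas apply to them.
\<close>

locale mixture_sources = prob_space M for M :: "'w measure" +
  fixes Z W \<epsilon> :: "'w \<Rightarrow> real" and S :: "'w \<Rightarrow> real \<times> real"
  assumes sources_indep:
    "indep_vars (\<lambda>_. borel) (\<lambda>k. [\<lambda>\<omega>. (Z \<omega>, 0), \<lambda>\<omega>. (W \<omega>, 0), \<lambda>\<omega>. (\<epsilon> \<omega>, 0), S] ! k) {..<4::nat}"
begin

abbreviation "source \<equiv> (\<lambda>k::nat. [\<lambda>\<omega>. (Z \<omega>, 0), \<lambda>\<omega>. (W \<omega>, 0), \<lambda>\<omega>. (\<epsilon> \<omega>, 0), S] ! k)"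

lemma sources_measurable [measurable]:
  "Z \<in> borel_measurable M" "W \<in> borel_measurable M" "\<epsilon> \<in> borel_measurable M" "S \<in> borel_measurable M"
proof -
  have s: "source k \<in> borel_measurable M" if "k < 4" for k
    using sources_indep that by (simp add: indep_vars_def)
  have f: "(\<lambda>\<omega>. fst (source k \<omega>)) \<in> borel_measurable M" if "k < 4" for k
    using measurable_compose[OF s[OF that], of fst borel]
    by (simp add: borel_measurable_continuous_onI continuous_on_fst)
  show "Z \<in> borel_measurable M" "W \<in> borel_measurable M" "\<epsilon> \<in> borel_measurable M" "S \<in> borel_measurable M"
    using f[of 0] f[of 1] f[of 2] s[of 3] by simp_all
qed

text \<open>With the index blocks \<open>{0}\<close> and \<open>{1, 3}\<close>, \<open>Z\<close> is
  integrated out while \<open>W\<close> and the pair of field values are frozen.\<close>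

lemma nn_integral_split_Z:
  fixes h :: "real \<Rightarrow> real \<Rightarrow> real \<Rightarrow> real \<Rightarrow> ennreal"
  assumes h: "(\<lambda>(z, w, x, y). h z w x y) \<in> borel_measurable (borel \<Otimes>\<^sub>M borel \<Otimes>\<^sub>M borel \<Otimes>\<^sub>M borel)"
  shows "(\<integral>\<^sup>+\<omega>. h (Z \<omega>) (W \<omega>) (fst (S \<omega>)) (snd (S \<omega>)) \<partial>M)
    = (\<integral>\<^sup>+\<omega>. (\<integral>\<^sup>+\<omega>'. h (Z \<omega>') (W \<omega>) (fst (S \<omega>)) (snd (S \<omega>)) \<partial>M) \<partial>M)"
proof -
  let ?H = "\<lambda>(x, y). h (fst (x 0)) (fst (y 1)) (fst (y 3)) (snd (y 3)) :: ennreal"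
  \<comment> \<open>Rewriting the Borel sigma-algebra on pairs as a product makes \<open>fst\<close>
    and \<open>snd\<close> measurable projections.\<close>
  have "(\<lambda>(x, y). (fst (x 0), fst (y 1), fst (y 3), snd (y 3)))
    \<in> measurable (PiM {0::nat} (\<lambda>_. borel :: (real \<times> real) measure) \<Otimes>\<^sub>M PiM {1, 3::nat} (\<lambda>_. borel :: (real \<times> real) measure))
       (borel \<Otimes>\<^sub>M borel \<Otimes>\<^sub>M borel \<Otimes>\<^sub>M borel)"
    unfolding borel_prod[symmetric] by measurable
  from measurable_compose[OF this h]
  have "?H \<in> borel_measurable (PiM {0::nat} (\<lambda>_. borel :: (real \<times> real) measure) \<Otimes>\<^sub>M PiM {1, 3::nat} (\<lambda>_. borel :: (real \<times> real) measure))"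
    by (simp add: case_prod_beta')
  from nn_integral_indep_restrict[OF sources_indep _ _ _ this]
  show ?thesis by simp
qed

text \<open>With the index blocks \<open>{3}\<close> and \<open>{1}\<close>, the field values are
  integrated out while \<open>W\<close> is frozen, which leaves an expectation over
  \<open>W\<close>.\<close>

lemma nn_integral_split_W:
  fixes h :: "real \<Rightarrow> real \<Rightarrow> real \<Rightarrow> ennreal"
  assumes h: "(\<lambda>(w, x, y). h w x y) \<in> borel_measurable (borel \<Otimes>\<^sub>M borel \<Otimes>\<^sub>M borel)"
  shows "(\<integral>\<^sup>+\<omega>. h (W \<omega>) (fst (S \<omega>)) (snd (S \<omega>)) \<partial>M)
    = (\<integral>\<^sup>+\<omega>. (\<integral>\<^sup>+\<omega>'. h (W \<omega>) (fst (S \<omega>')) (snd (S \<omega>')) \<partial>M) \<partial>M)"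
proof -
  let ?H = "\<lambda>(x, y). h (fst (y 1)) (fst (x 3)) (snd (x 3)) :: ennreal"
  have "(\<lambda>(x, y). (fst (y 1), fst (x 3), snd (x 3)))
    \<in> measurable (PiM {3::nat} (\<lambda>_. borel :: (real \<times> real) measure) \<Otimes>\<^sub>M PiM {1::nat} (\<lambda>_. borel :: (real \<times> real) measure))
       (borel \<Otimes>\<^sub>M borel \<Otimes>\<^sub>M borel)"
    unfolding borel_prod[symmetric] by measurable
  from measurable_compose[OF this h]
  have "?H \<in> borel_measurable (PiM {3::nat} (\<lambda>_. borel :: (real \<times> real) measure) \<Otimes>\<^sub>M PiM {1::nat} (\<lambda>_. borel :: (real \<times> real) measure))"
    by (simp add: case_prod_beta')
  from nn_integral_indep_restrict[OF sources_indep _ _ _ this]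
  show ?thesis by simp
qed

text \<open>The index blocks are \<open>{2}\<close> and \<open>{0, 1, 3}\<close>. The function
  \<open>f\<close> is general because the mean needs the noise itself and the covariance its
  square.\<close>

lemma indep_noise:
  fixes h :: "real \<Rightarrow> real \<Rightarrow> real \<Rightarrow> real \<Rightarrow> real" and f :: "real \<Rightarrow> real"
  assumes h: "(\<lambda>(z, w, x, y). h z w x y) \<in> borel_measurable (borel \<Otimes>\<^sub>M borel \<Otimes>\<^sub>M borel \<Otimes>\<^sub>M borel)"
    and [measurable]: "f \<in> borel_measurable borel"
  shows "indep_var borel (\<lambda>\<omega>. f (\<epsilon> \<omega>)) borel (\<lambda>\<omega>. h (Z \<omega>) (W \<omega>) (fst (S \<omega>)) (snd (S \<omega>)))"
proof -
  have "(\<lambda>x. (fst (x 0), fst (x 1), fst (x 3), snd (x 3)))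
    \<in> measurable (PiM {0, 1, 3::nat} (\<lambda>_. borel :: (real \<times> real) measure))
       (borel \<Otimes>\<^sub>M borel \<Otimes>\<^sub>M borel \<Otimes>\<^sub>M borel)"
    unfolding borel_prod[symmetric] by measurable
  from measurable_compose[OF this h]
  have 1: "(\<lambda>x. h (fst (x 0)) (fst (x 1)) (fst (x 3)) (snd (x 3)))
      \<in> borel_measurable (PiM {0, 1, 3::nat} (\<lambda>_. borel :: (real \<times> real) measure))"
    by (simp add: case_prod_beta')
  have 2: "(\<lambda>x. f (fst (x 2))) \<in> borel_measurable (PiM {2::nat} (\<lambda>_. borel :: (real \<times> real) measure))"
    unfolding borel_prod[symmetric] by measurable
  have "indep_var (PiM {2} (\<lambda>_. borel)) (\<lambda>\<omega>. \<lambda>i\<in>{2}. source i \<omega>)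
      (PiM {0, 1, 3} (\<lambda>_. borel)) (\<lambda>\<omega>. \<lambda>i\<in>{0, 1, 3}. source i \<omega>)"
    by (rule indep_var_restrict[OF sources_indep]) auto
  from indep_var_compose[OF this 2 1] show ?thesis
    by (simp add: comp_def)
qed

end

text \<open>The integrand is nonnegative, so \<open>Z\<close> and then the field can be integrated
  out by Tonelli before any integrability is known.\<close>

lemma nn_integral_smoothing_expectation:
  fixes Z W \<epsilon> D D' :: "'w \<Rightarrow> real"
  assumes "mixture_sources M Z W \<epsilon> (\<lambda>\<omega>. (D \<omega>, D' \<omega>))"
    and Z: "distributed M lborel Z (\<lambda>z. ennreal (g z))"
    and g: "\<And>z. 0 \<le> g z" "AE z in lborel. 0 < g z"
    and W: "AE \<omega> in M. 0 < W \<omega>"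
    and D: "distr M borel (\<lambda>\<omega>. D \<omega> - D' \<omega>) = normal_law 0 \<tau>" "0 \<le> \<tau>"
    and pos: "0 < a" "0 < b" "0 < a'" "0 < b'"
  shows "(\<integral>\<^sup>+\<omega>. ennreal (smoothing g a b (Z \<omega>) (W \<omega>) (D \<omega>) * smoothing g a' b' (Z \<omega>) (W \<omega>) (D' \<omega>)) \<partial>M)
    = (\<integral>\<^sup>+\<omega>. ennreal (sqrt (b * b') / sqrt ((a + a') / 2 + \<tau> * W \<omega>)) \<partial>M)"
proof -
  interpret mixture_sources M Z W \<epsilon> "\<lambda>\<omega>. (D \<omega>, D' \<omega>)" by fact
  have [measurable]: "D \<in> borel_measurable M" "D' \<in> borel_measurable M"
    using measurable_compose[OF sources_measurable(4), of fst borel]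
      measurable_compose[OF sources_measurable(4), of snd borel]
    by (simp_all add: borel_measurable_continuous_onI continuous_on_fst continuous_on_snd)
  \<comment> \<open>\<open>distributed\<close> provides measurability of
    \<open>ennreal (g z)\<close>; nonnegativity lets \<open>g\<close> itself be read back from
    it.\<close>
  have "(\<lambda>z. enn2real (ennreal (g z))) \<in> borel_measurable borel"
    using Z by (intro borel_measurable_enn2real) (simp add: distributed_def)
  then have [measurable]: "g \<in> borel_measurable borel"
    using g(1) by simp
  let ?c = "sqrt (b * b') / sqrt ((a + a') / 2)"
  let ?h = "\<lambda>z w x y. ennreal (smoothing g a b z w x * smoothing g a' b' z w y)"
  let ?k = "\<lambda>w x y. ennreal (?c * exp (- (w / (a + a')) * (x - y)\<^sup>2))"
  have "(\<integral>\<^sup>+\<omega>. ?h (Z \<omega>) (W \<omega>) (D \<omega>) (D' \<omega>) \<partial>M)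
      = (\<integral>\<^sup>+\<omega>. (\<integral>\<^sup>+\<omega>'. ?h (Z \<omega>') (W \<omega>) (D \<omega>) (D' \<omega>) \<partial>M) \<partial>M)"
    using nn_integral_split_Z[of ?h] by simp
  also have "\<dots> = (\<integral>\<^sup>+\<omega>. ?k (W \<omega>) (D \<omega>) (D' \<omega>) \<partial>M)"
  proof (rule nn_integral_cong_AE, use W in eventually_elim)
    case (elim \<omega>)
    have "(\<integral>\<^sup>+\<omega>'. ?h (Z \<omega>') (W \<omega>) (D \<omega>) (D' \<omega>) \<partial>M)
        = (\<integral>\<^sup>+z. ennreal (g z) * ?h z (W \<omega>) (D \<omega>) (D' \<omega>) \<partial>lborel)"
      by (rule distributed_nn_integral[OF Z, symmetric]) simp
    then show ?case
      using nn_integral_smoothing_mult[OF _ g pos elim] by simp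
  qed
  \<comment> \<open>With \<open>Z\<close> gone, the integrand sees the field only through its
    increment, whose law is known.\<close>
  also have "\<dots> = (\<integral>\<^sup>+\<omega>. (\<integral>\<^sup>+\<omega>'. ?k (W \<omega>) (D \<omega>') (D' \<omega>') \<partial>M) \<partial>M)"
    using nn_integral_split_W[of ?k] by simp
  also have "\<dots> = (\<integral>\<^sup>+\<omega>. ennreal (sqrt (b * b') / sqrt ((a + a') / 2 + \<tau> * W \<omega>)) \<partial>M)"
  proof (rule nn_integral_cong_AE, use W in eventually_elim)
    case (elim \<omega>)
    have c: "0 \<le> ?c" using pos by simp
    have "(\<integral>\<^sup>+\<omega>'. ?k (W \<omega>) (D \<omega>') (D' \<omega>') \<partial>M)
        = (\<integral>\<^sup>+\<omega>'. ennreal ?c * ennreal (exp (- (W \<omega> / (a + a')) * (D \<omega>' - D' \<omega>')\<^sup>2)) \<partial>M)"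
      using c by (simp only: ennreal_mult')
    also have "\<dots> = ennreal ?c * ennreal (1 / sqrt (1 + 2 * (W \<omega> / (a + a')) * \<tau>))"
      using elim pos nn_integral_exp_gaussian[OF _ D, where k = "W \<omega> / (a + a')"]
      by (subst nn_integral_cmult) simp_all
    also have "\<dots> = ennreal (?c * (1 / sqrt (1 + 2 * (W \<omega> / (a + a')) * \<tau>)))"
      using c by (simp only: ennreal_mult')
    \<comment> \<open>Moving \<alpha> = \<open>(a + a') / 2\<close> under the second root gives
      \<alpha> (1 + \<tau> w / \<alpha>) = \<alpha> + \<tau> w.\<close>
    also have "?c * (1 / sqrt (1 + 2 * (W \<omega> / (a + a')) * \<tau>))
        = sqrt (b * b') / sqrt ((a + a') / 2 * (1 + 2 * (W \<omega> / (a + a')) * \<tau>))"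
      by (simp only: real_sqrt_mult times_divide_times_eq mult_1_right)
    also have "(a + a') / 2 * (1 + 2 * (W \<omega> / (a + a')) * \<tau>) = (a + a') / 2 + \<tau> * W \<omega>"
      using pos by (simp add: field_simps)
    finally show ?case .
  qed
  finally show ?thesis .
qed

section \<open>From independent families of events to independent sources\<close>

text \<open>A preimage under a composition with \<open>X\<close> is itself a preimage under
  \<open>X\<close>.\<close>

lemma generated_events_comp_subset:
  assumes "X \<in> measurable M N" "f \<in> measurable N N'"
    and "\<And>\<omega>. \<omega> \<in> space M \<Longrightarrow> Y \<omega> = f (X \<omega>)"
  shows "generated_events M N' Y \<subseteq> generated_events M N X"
proof
  fix E assume "E \<in> generated_events M N' Y"
  then obtain S where S: "S \<in> sets N'" "E = Y -` S \<inter> space M"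
    by (auto simp: generated_events_def)
  have "E = X -` (f -` S \<inter> space N) \<inter> space M"
    using S(2) assms(3) measurable_space[OF assms(1)] by auto
  then show "E \<in> generated_events M N X"
    using measurable_sets[OF assms(2) S(1)] unfolding generated_events_def by blast
qed

text \<open>Independence is inherited by smaller families of events, and every source is a
  measurable function of one of the given random elements: padding by 0, or evaluation of the field
  at two points.\<close>

lemma mixture_sources_field:
  assumes "prob_space M"
    and meas: "Z \<in> borel_measurable M" "W \<in> borel_measurable M" "\<epsilon> \<in> borel_measurable M"
      "\<And>s. s \<in> L \<Longrightarrow> A s \<in> borel_measurable M"
    and indep: "prob_space.indep_sets M
      (\<lambda>k. [generated_events M borel Z, generated_events M borel W, generated_events M borel \<epsilon>,
            generated_events M (PiM L (\<lambda>_. borel)) (field_map L A)] ! k) {..<4::nat}"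
    and st: "s \<in> L" "t \<in> L"
  shows "mixture_sources M Z W \<epsilon> (\<lambda>\<omega>. (A s \<omega>, A t \<omega>))"
proof -
  interpret prob_space M by fact
  let ?Y = "\<lambda>k::nat. [\<lambda>\<omega>. (Z \<omega>, 0), \<lambda>\<omega>. (W \<omega>, 0), \<lambda>\<omega>. (\<epsilon> \<omega>, 0), \<lambda>\<omega>. (A s \<omega>, A t \<omega>)] ! k"
  have four: "k = 0 \<or> k = 1 \<or> k = 2 \<or> k = 3" if "k < 4" for k :: nat
    using that by linarith
  have field: "field_map L A \<in> measurable M (PiM L (\<lambda>_. borel))"
    unfolding field_map_def by (intro measurable_restrict meas)
  have pad: "generated_events M borel (\<lambda>\<omega>. (V \<omega>, 0 :: real)) \<subseteq> generated_events M borel V"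
    if "V \<in> borel_measurable M" for V :: "'a \<Rightarrow> real"
    using that by (rule generated_events_comp_subset[where f = "\<lambda>x. (x, 0)"]) simp_all
  have pair: "generated_events M borel (\<lambda>\<omega>. (A s \<omega>, A t \<omega>))
      \<subseteq> generated_events M (PiM L (\<lambda>_. borel)) (field_map L A)"
  proof (rule generated_events_comp_subset[where f = "\<lambda>x. (x s, x t)"])
    show "(\<lambda>x. (x s, x t)) \<in> borel_measurable (PiM L (\<lambda>_. borel :: real measure))"
      using st by (intro borel_measurable_Pair measurable_component_singleton)
  qed (use field st in \<open>auto simp: field_map_def\<close>)
  have "indep_sets (\<lambda>k. generated_events M borel (?Y k)) {..<4}"
    using pad[OF meas(1)] pad[OF meas(2)] pad[OF meas(3)] pair
    by (intro indep_sets_mono_sets[OF indep]) (auto dest!: four)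
  moreover have "?Y k \<in> borel_measurable M" if "k < 4" for k
    using four[OF that] meas st by auto
  \<comment> \<open>\<open>indep_vars_def2\<close> speaks of plain preimages, which is the form of
    \<open>generated_events\<close>.\<close>
  ultimately have "indep_vars (\<lambda>_. borel) ?Y {..<4}"
    by (auto simp: indep_vars_def2 generated_events_def)
  then show ?thesis
    by unfold_locales
qed

section \<open>Mean and covariance of the random field\<close>

theorem proposition4p1:
  fixes M :: "'w measure"
    and m :: nat and p q :: "nat \<Rightarrow> real ^ 2"
    and v :: "'n::finite \<Rightarrow> real ^ 2" and r :: 'n
    and L :: "(real ^ 2) set"
    and A X :: "real ^ 2 \<Rightarrow> 'w \<Rightarrow> real"
    and a b :: "real ^ 2 \<Rightarrow> real" and \<alpha> :: "real ^ 2 \<Rightarrow> real ^ 2 \<Rightarrow> real"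
    and F :: "real measure"
    and Z W \<epsilon> :: "'w \<Rightarrow> real" and g :: "real \<Rightarrow> real"
  assumes M: "prob_space M"
    and network: "linear_network m p q"
    and L: "L = network m p q"
    and vertices: "bij_betw v UNIV (vertices m p q)"
    and A: "auxiliary_field M m p q v r A"
    and a: "\<forall>s\<in>L. 0 < a s"
    and b: "\<forall>s\<in>L. 0 < b s"
    and \<alpha>: "\<forall>s\<in>L. \<forall>t\<in>L. \<alpha> s t = (a s + a t) / 2"
    and F: "prob_space F" "sets F = sets borel" "measure F {0<..} = 1"
    and Z: "distributed M lborel Z (\<lambda>z. ennreal (g z))"
    and g: "\<forall>z. 0 \<le> g z" "AE z in lborel. 0 < g z"
    and W: "W \<in> borel_measurable M" "AE \<omega> in M. 0 < W \<omega>" "distr M borel W = F"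
    and \<epsilon>: "\<epsilon> \<in> borel_measurable M" "integrable M \<epsilon>" "integrable M (\<lambda>\<omega>. (\<epsilon> \<omega>)\<^sup>2)"
      "prob_space.expectation M \<epsilon> = 0" "prob_space.variance M \<epsilon> = 1"
    and indep: "prob_space.indep_sets M
      (\<lambda>k. [generated_events M borel Z, generated_events M borel W, generated_events M borel \<epsilon>,
            generated_events M (PiM L (\<lambda>_. borel)) (field_map L A)] ! k) {..<4::nat}"
    and X: "\<forall>s\<in>L. \<forall>\<omega>\<in>space M. X s \<omega> =
      \<epsilon> \<omega> * sqrt (b s / g (Z \<omega>)) * (pi / W \<omega>) powr (1 / 4)
        * normal_density (A s \<omega> / sqrt 2) (sqrt (a s / (4 * W \<omega>))) (Z \<omega>)"
  shows "(\<forall>s\<in>L. integrable M (X s) \<and> prob_space.expectation M (X s) = 0) \<and>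
    (\<forall>s\<in>L. \<forall>t\<in>L.
       integrable M (\<lambda>\<omega>. X s \<omega> * X t \<omega>) \<and>
       set_integrable F {0<..}
         (\<lambda>w. sqrt (b s * b t) / sqrt (\<alpha> s t + resistance_metric M A s t * w)) \<and>
       covariance M (X s) (X t) =
         (LINT w:{0<..}|F. sqrt (b s * b t) / sqrt (\<alpha> s t + resistance_metric M A s t * w)))"
proof -
  interpret prob_space M by fact
  have "(\<lambda>z. enn2real (ennreal (g z))) \<in> borel_measurable borel"
    using Z by (intro borel_measurable_enn2real) (simp add: distributed_def)
  then have g_meas [measurable]: "g \<in> borel_measurable borel"
    using g(1) by simp
  have Z_meas [measurable]: "Z \<in> borel_measurable M"
    using Z by (simp add: distributed_def)
  note W(1) [measurable] \<epsilon>(1) [measurable]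
  have A_meas: "A s \<in> borel_measurable M" if "s \<in> L" for s
    using auxiliary_field_measurable[OF M A] that by (simp add: L)
  have sources: "mixture_sources M Z W \<epsilon> (\<lambda>\<omega>. (A s \<omega>, A t \<omega>))" if "s \<in> L" "t \<in> L" for s t
    by (rule mixture_sources_field[OF M Z_meas W(1) \<epsilon>(1) A_meas indep that])
  \<comment> \<open>\<open>K\<close> is the field without its noise factor; it is nonnegative,
    unlike \<open>X\<close>.\<close>
  define K where "K s \<omega> = smoothing g (a s) (b s) (Z \<omega>) (W \<omega>) (A s \<omega>)" for s \<omega>
  have K_fun: "K s = (\<lambda>\<omega>. smoothing g (a s) (b s) (Z \<omega>) (W \<omega>) (A s \<omega>))" for s
    by (simp add: K_def fun_eq_iff)
  have XK: "X s \<omega> = \<epsilon> \<omega> * K s \<omega>" if "s \<in> L" "\<omega> \<in> space M" for s \<omega>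
    using X that by (simp add: K_def smoothing_def mult.assoc)
  have K_meas [measurable]: "K s \<in> borel_measurable M" if "s \<in> L" for s
    unfolding K_def using A_meas[OF that] by measurable
  have K_nonneg: "0 \<le> K s \<omega>" if "s \<in> L" for s \<omega>
    using b g(1) that by (simp add: K_def smoothing_nonneg less_imp_le)
  define f where "f s t w = sqrt (b s * b t) / sqrt (\<alpha> s t + resistance_metric M A s t * w)" for s t w

  \<comment> \<open>The case \<open>t = s\<close> is included and later provides square
    integrability of \<open>K s\<close>.\<close>
  have second_moment: "integrable M (\<lambda>\<omega>. K s \<omega> * K t \<omega>) \<and> set_integrable F {0<..} (f s t) \<and>
      expectation (\<lambda>\<omega>. K s \<omega> * K t \<omega>) = (LINT w:{0<..}|F. f s t w)" if st: "s \<in> L" "t \<in> L" for s t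
  proof -
    have pos: "0 < a s" "0 < b s" "0 < a t" "0 < b t" and \<alpha>': "\<alpha> s t = (a s + a t) / 2"
      using st a b \<alpha> by auto
    obtain \<tau> where \<tau>: "0 \<le> \<tau>" "distr M borel (\<lambda>\<omega>. A s \<omega> - A t \<omega>) = normal_law 0 \<tau>"
      using auxiliary_field_diff_gaussian[OF M vertices A] st
      unfolding centered_gaussian_def L by metis
    have "resistance_metric M A s t = \<tau>"
      unfolding resistance_metric_def
      using A_meas st \<tau> by (intro centered_gaussian_variance) auto
    then have f: "f s t w = sqrt (b s * b t) / sqrt ((a s + a t) / 2 + \<tau> * w)" for w
      by (simp add: f_def \<alpha>')
    have [measurable]: "f s t \<in> borel_measurable borel"
      unfolding f by measurable
    \<comment> \<open>The cutoff removes \<open>w \<le> 0\<close>, where the argument of the root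
      may be negative. On the rest \<open>f s t\<close> is nonnegative and bounded by its value at
      \<open>w = 0\<close>.\<close>
    let ?h = "\<lambda>w. indicator {0<..} w * f s t w"
    have h_nonneg: "0 \<le> ?h w" for w
      using pos \<tau>(1) by (auto simp: f indicator_def)
    interpret F: prob_space F by fact
    have "integrable F ?h"
    proof (rule F.integrable_const_bound)
      show "AE w in F. norm (?h w) \<le> sqrt (b s * b t) / sqrt ((a s + a t) / 2)"
        using pos \<tau>(1) h_nonneg
        by (intro always_eventually allI)
           (auto simp: f indicator_def intro!: divide_left_mono mult_pos_pos add_pos_nonneg)
      show "?h \<in> borel_measurable F"
        by (subst measurable_cong_sets[OF F(2) refl]) measurable
    qed
    then have set_int: "set_integrable F {0<..} (f s t)"
      by (simp add: set_integrable_def)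
    have "(\<integral>\<^sup>+\<omega>. ennreal (K s \<omega> * K t \<omega>) \<partial>M) = (\<integral>\<^sup>+\<omega>. ennreal (f s t (W \<omega>)) \<partial>M)"
      unfolding K_def f
      by (rule nn_integral_smoothing_expectation[OF sources[OF st] Z g(1)[rule_format] g(2) W(2) \<tau>(2,1) pos])
    also have "\<dots> = (\<integral>\<^sup>+\<omega>. ennreal (?h (W \<omega>)) \<partial>M)"
      using W(2) by (intro nn_integral_cong_AE) (auto elim!: eventually_mono)
    also have "\<dots> = (\<integral>\<^sup>+w. ennreal (?h w) \<partial>F)"
      by (simp add: nn_integral_distr flip: W(3))
    also have "\<dots> = ennreal (\<integral>w. ?h w \<partial>F)"
      using h_nonneg by (intro nn_integral_eq_integral[OF \<open>integrable F ?h\<close>]) simp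
    finally have "(\<integral>\<^sup>+\<omega>. ennreal (K s \<omega> * K t \<omega>) \<partial>M) = ennreal (\<integral>w. ?h w \<partial>F)" .
    \<comment> \<open>For a nonnegative measurable function, a finite nonnegative integral yields
      integrability and the value at once.\<close>
    then have "integrable M (\<lambda>\<omega>. K s \<omega> * K t \<omega>) \<and> expectation (\<lambda>\<omega>. K s \<omega> * K t \<omega>) = (\<integral>w. ?h w \<partial>F)"
      using K_nonneg st h_nonneg K_meas
      by (subst nn_integral_eq_integrable[symmetric]) (auto intro!: integral_nonneg_AE)
    with set_int show ?thesis
      by (simp add: set_lebesgue_integral_def)
  qed

  have mean: "integrable M (X s) \<and> expectation (X s) = 0" if s: "s \<in> L" for s
  proof -
    interpret mixture_sources M Z W \<epsilon> "\<lambda>\<omega>. (A s \<omega>, A s \<omega>)"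
      by (rule sources[OF s s])
    \<comment> \<open>On a probability space a finite second moment implies integrability.\<close>
    have "integrable M (\<lambda>\<omega>. (K s \<omega>)\<^sup>2)"
      using second_moment[OF s s] by (simp add: power2_eq_square)
    then have int: "integrable M (K s)"
      by (rule square_integrable_imp_integrable[OF K_meas[OF s]])
    have iv: "indep_var borel \<epsilon> borel (K s)"
    proof -
      have "(\<lambda>(z, w, x, y). smoothing g (a s) (b s) z w x)
          \<in> borel_measurable (borel \<Otimes>\<^sub>M borel \<Otimes>\<^sub>M borel \<Otimes>\<^sub>M (borel :: real measure))"
        by measurable
      from indep_noise[OF this measurable_ident_sets[OF refl]] show ?thesis
        by (simp add: K_fun)
    qed
    have "integrable M (\<lambda>\<omega>. \<epsilon> \<omega> * K s \<omega>) \<and> expectation (\<lambda>\<omega>. \<epsilon> \<omega> * K s \<omega>) = 0"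
      using indep_var_integrable[OF iv \<epsilon>(2) int] indep_var_lebesgue_integral[OF iv \<epsilon>(2) int] \<epsilon>(4)
      by simp
    then show ?thesis
      using XK[OF s] by (simp cong: Bochner_Integration.integrable_cong Bochner_Integration.integral_cong)
  qed

  have product: "integrable M (\<lambda>\<omega>. X s \<omega> * X t \<omega>) \<and> set_integrable F {0<..} (f s t) \<and>
      covariance M (X s) (X t) = (LINT w:{0<..}|F. f s t w)" if st: "s \<in> L" "t \<in> L" for s t
  proof -
    interpret mixture_sources M Z W \<epsilon> "\<lambda>\<omega>. (A s \<omega>, A t \<omega>)"
      by (rule sources[OF st])
    have KK: "integrable M (\<lambda>\<omega>. K s \<omega> * K t \<omega>)"
      using second_moment[OF st] by simp
    have iv: "indep_var borel (\<lambda>\<omega>. (\<epsilon> \<omega>)\<^sup>2) borel (\<lambda>\<omega>. K s \<omega> * K t \<omega>)"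
    proof -
      have "(\<lambda>(z, w, x, y). smoothing g (a s) (b s) z w x * smoothing g (a t) (b t) z w y)
          \<in> borel_measurable (borel \<Otimes>\<^sub>M borel \<Otimes>\<^sub>M borel \<Otimes>\<^sub>M borel)"
        by measurable
      from indep_noise[OF this, of "\<lambda>x. x\<^sup>2"] show ?thesis
        by (simp add: K_fun)
    qed
    have "expectation (\<lambda>\<omega>. (\<epsilon> \<omega>)\<^sup>2) = 1"
      using \<epsilon>(4,5) by simp
    then have "integrable M (\<lambda>\<omega>. (\<epsilon> \<omega>)\<^sup>2 * (K s \<omega> * K t \<omega>)) \<and>
        expectation (\<lambda>\<omega>. (\<epsilon> \<omega>)\<^sup>2 * (K s \<omega> * K t \<omega>)) = expectation (\<lambda>\<omega>. K s \<omega> * K t \<omega>)"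
      using indep_var_integrable[OF iv \<epsilon>(3) KK] indep_var_lebesgue_integral[OF iv \<epsilon>(3) KK]
      by simp
    moreover have "X s \<omega> * X t \<omega> = (\<epsilon> \<omega>)\<^sup>2 * (K s \<omega> * K t \<omega>)" if "\<omega> \<in> space M" for \<omega>
      using XK st that by (simp add: power2_eq_square mult_ac)
    ultimately have "integrable M (\<lambda>\<omega>. X s \<omega> * X t \<omega>) \<and>
        expectation (\<lambda>\<omega>. X s \<omega> * X t \<omega>) = expectation (\<lambda>\<omega>. K s \<omega> * K t \<omega>)"
      by (simp cong: Bochner_Integration.integrable_cong Bochner_Integration.integral_cong)
    \<comment> \<open>Both means vanish, so the covariance is the expectation of the
      product.\<close>
    then show ?thesis
      using second_moment[OF st] mean st by (simp add: covariance_def)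
  qed

  show ?thesis
    using mean product unfolding f_def by blast
qed

end
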